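(* Let $p$ be a prime with $p\neq 2,3$, and let $G=\langle a,b,c,d\mid a^{2}=b^{2}=c^{p}=d^{p}=[a,b]=[a,c]=[a,d]=[b,d]=[c,d]=1,\ b^{-1}cb=c^{-1}\rangle$. Then $\mathrm{Aut}(G)\simeq\mathbb{Z}_{p}\rtimes((\mathbb{Z}_{p-1}\times\mathbb{Z}_{p-1})\times\mathbb{Z}_{2})$.
   Context: $\mathbb{Z}_n$ is the cyclic group of order $n$; $[x,y]=x^{-1}y^{-1}xy$. (This is a group of order $p^2q^2$ with $q=2$, $p\neq q$ and $pq\neq 6$.) $X\rtimes Y$ denotes a semidirect product with normal subgroup $X$ with respect to some homomorphism $Y\to\mathrm{Aut}(X)$; the statement asserts that $\mathrm{Aut}(G)$ is isomorphic to such a semidirect product for some choice of action. *)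

theory Defs
  imports "HOL-Algebra.Algebra" "HOL-Computational_Algebra.Primes"
begin

section \<open>Free groups\<close>

text \<open>A letter \<open>(x, True)\<close> stands for the generator \<open>x\<close>, a letter \<open>(x, False)\<close> for its formal
  inverse. The free group on the type \<open>'x\<close> consists of the words in these letters modulo the
  equivalence generated by deleting adjacent pairs of mutually inverse letters.\<close>

type_synonym 'x word = "('x \<times> bool) list"

inductive cancels :: "'x word \<Rightarrow> 'x word \<Rightarrow> bool" where
  "cancels (u @ [(x, s), (x, \<not> s)] @ v) (u @ v)"

definition free_rel :: "('x word \<times> 'x word) set" where
  "free_rel = {(u, v). equivclp cancels u v}"

definition word_class :: "'x word \<Rightarrow> 'x word set" where
  "word_class w = free_rel `` {w}"

definition free_group :: "'x word set monoid" where
  "free_group =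
    \<lparr>carrier = UNIV // free_rel,
     monoid.mult = (\<lambda>P Q. \<Union>u\<in>P. \<Union>v\<in>Q. word_class (u @ v)),
     one = word_class []\<rparr>"

definition free_gen :: "'x \<Rightarrow> 'x word set" where
  "free_gen x = word_class [(x, True)]"

lemma equiv_free_rel: "equiv UNIV free_rel"
  by (auto simp: free_rel_def intro!: equivI reflI symI transI dest: equivclp_sym equivclp_trans)

lemma word_class_eq_iff: "word_class u = word_class v \<longleftrightarrow> equivclp cancels u v"
  using equiv_class_eq_iff[OF equiv_free_rel, of u v] by (simp add: word_class_def free_rel_def)

lemma cancels_append:
  assumes "cancels u v"
  shows "cancels (l @ u @ r) (l @ v @ r)"
  using assms
proof cases
  case (1 u' x s v')
  then show ?thesis
    using cancels.intros[of "l @ u'" x s "v' @ r"] by simp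
qed

lemma equivclp_cancels_context:
  assumes "equivclp cancels u v"
  shows "equivclp cancels (l @ u @ r) (l @ v @ r)"
  using assms
proof (induction rule: equivclp_induct)
  case base
  show ?case by simp
next
  case (step y z)
  then show ?case
    by (meson cancels_append equivclp_sym equivclp_trans r_into_equivclp)
qed

lemma equivclp_cancels_append:
  assumes "equivclp cancels u u'" "equivclp cancels v v'"
  shows "equivclp cancels (u @ v) (u' @ v')"
  using equivclp_cancels_context[OF assms(1), of "[]" v]
    equivclp_cancels_context[OF assms(2), of u' "[]"]
  by (auto intro: equivclp_trans)

lemma carrier_free_group: "carrier free_group = range word_class"
  by (auto simp: free_group_def quotient_def word_class_def)

lemma one_free_group: "\<one>\<^bsub>free_group\<^esub> = word_class []"
  by (simp add: free_group_def)

lemma mult_word_class: "word_class u \<otimes>\<^bsub>free_group\<^esub> word_class v = word_class (u @ v)"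
proof -
  have eq: "word_class (u' @ v') = word_class (u @ v)"
    if "u' \<in> word_class u" "v' \<in> word_class v" for u' v'
  proof -
    have "equivclp cancels u u'" "equivclp cancels v v'"
      using that by (simp_all add: word_class_def free_rel_def)
    then show ?thesis
      unfolding word_class_eq_iff by (intro equivclp_sym[OF equivclp_cancels_append])
  qed
  have "u \<in> word_class u" "v \<in> word_class v"
    by (simp_all add: word_class_def free_rel_def)
  then have "(\<Union>u'\<in>word_class u. \<Union>v'\<in>word_class v. word_class (u' @ v')) = word_class (u @ v)"
    using eq by blast
  then show ?thesis
    by (simp add: free_group_def)
qed

definition inv_word :: "'x word \<Rightarrow> 'x word" where
  "inv_word w = rev (map (\<lambda>(x, s). (x, \<not> s)) w)"

lemma word_class_inv_word: "word_class (inv_word w @ w) = word_class []"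
proof (induction w)
  case (Cons a w)
  obtain x s where a: "a = (x, s)" by fastforce
  have "cancels (inv_word (a # w) @ a # w) (inv_word w @ w)"
    using cancels.intros[of "inv_word w" x "\<not> s" w] by (simp add: inv_word_def a)
  then show ?case
    using Cons by (metis word_class_eq_iff r_into_equivclp)
qed (simp add: inv_word_def)

lemma group_free_group: "group free_group"
proof (rule groupI)
  fix x :: "'a word set"
  assume "x \<in> carrier free_group"
  then obtain w where "x = word_class w"
    by (auto simp: carrier_free_group)
  then have "word_class (inv_word w) \<otimes>\<^bsub>free_group\<^esub> x = \<one>\<^bsub>free_group\<^esub>"
    by (simp add: mult_word_class word_class_inv_word one_free_group)
  then show "\<exists>y\<in>carrier free_group. y \<otimes>\<^bsub>free_group\<^esub> x = \<one>\<^bsub>free_group\<^esub>"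
    by (auto simp: carrier_free_group)
qed (auto simp: carrier_free_group one_free_group mult_word_class)


section \<open>Groups given by generators and relations\<close>

definition normal_closure :: "('a, 'b) monoid_scheme \<Rightarrow> 'a set \<Rightarrow> 'a set" where
  "normal_closure G R = \<Inter>{N. N \<lhd> G \<and> R \<subseteq> N}"

text \<open>A relation \<open>u = v\<close> between elements of the free group is given as the pair \<open>(u, v)\<close>.\<close>

definition presented_group :: "('x word set \<times> 'x word set) set \<Rightarrow> 'x word set set monoid" where
  "presented_group rels =
     free_group Mod
       normal_closure free_group {u \<otimes>\<^bsub>free_group\<^esub> inv\<^bsub>free_group\<^esub> v | u v. (u, v) \<in> rels}"

lemma (in group) normal_closure_normal:
  assumes "R \<subseteq> carrier G"
  shows "normal_closure G R \<lhd> G"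
proof -
  have ne: "carrier G \<in> {N. N \<lhd> G \<and> R \<subseteq> N}"
    using assms normal_self by auto
  have "subgroup (normal_closure G R) G"
    unfolding normal_closure_def
    by (rule subgroups_Inter) (use ne in \<open>auto intro: normal_imp_subgroup\<close>)
  then show ?thesis
    unfolding normal_inv_iff by (auto simp: normal_closure_def normal_inv_iff)
qed

lemma group_presented_group:
  assumes "rels \<subseteq> carrier free_group \<times> carrier free_group"
  shows "group (presented_group rels)"
proof -
  interpret F: group free_group by (rule group_free_group)
  show ?thesis
    unfolding presented_group_def
    by (intro normal.factorgroup_is_group F.normal_closure_normal) (use assms in auto)
qed

definition group_commutator :: "('a, 'b) monoid_scheme \<Rightarrow> 'a \<Rightarrow> 'a \<Rightarrow> 'a" where
  "group_commutator G x y = inv\<^bsub>G\<^esub> x \<otimes>\<^bsub>G\<^esub> inv\<^bsub>G\<^esub> y \<otimes>\<^bsub>G\<^esub> x \<otimes>\<^bsub>G\<^esub> y"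

datatype gens = gen_a | gen_b | gen_c | gen_d

definition G_rels :: "nat \<Rightarrow> (gens word set \<times> gens word set) set" where
  "G_rels p =
    (let F = free_group; a = free_gen gen_a; b = free_gen gen_b;
         c = free_gen gen_c; d = free_gen gen_d
     in {(a [^]\<^bsub>F\<^esub> (2::nat), \<one>\<^bsub>F\<^esub>), (b [^]\<^bsub>F\<^esub> (2::nat), \<one>\<^bsub>F\<^esub>),
         (c [^]\<^bsub>F\<^esub> p, \<one>\<^bsub>F\<^esub>), (d [^]\<^bsub>F\<^esub> p, \<one>\<^bsub>F\<^esub>),
         (group_commutator F a b, \<one>\<^bsub>F\<^esub>), (group_commutator F a c, \<one>\<^bsub>F\<^esub>),
         (group_commutator F a d, \<one>\<^bsub>F\<^esub>), (group_commutator F b d, \<one>\<^bsub>F\<^esub>),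
         (group_commutator F c d, \<one>\<^bsub>F\<^esub>),
         (inv\<^bsub>F\<^esub> b \<otimes>\<^bsub>F\<^esub> c \<otimes>\<^bsub>F\<^esub> b, inv\<^bsub>F\<^esub> c)})"

lemma group_presented_group_G_rels: "group (presented_group (G_rels p))"
proof -
  interpret F: group "free_group :: gens word set monoid" by (rule group_free_group)
  have "free_gen x \<in> carrier free_group" for x :: gens
    by (simp add: free_gen_def carrier_free_group)
  then show ?thesis
    by (intro group_presented_group) (simp add: G_rels_def Let_def group_commutator_def)
qed


section \<open>Semidirect products\<close>

definition semidirect_product ::
  "('a, 'm) monoid_scheme \<Rightarrow> ('b, 'n) monoid_scheme \<Rightarrow> ('b \<Rightarrow> 'a \<Rightarrow> 'a) \<Rightarrow> ('a \<times> 'b) monoid" where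
  "semidirect_product K H \<phi> =
    \<lparr>carrier = carrier K \<times> carrier H,
     monoid.mult = (\<lambda>(x, y) (x', y'). (x \<otimes>\<^bsub>K\<^esub> \<phi> y x', y \<otimes>\<^bsub>H\<^esub> y')),
     one = (\<one>\<^bsub>K\<^esub>, \<one>\<^bsub>H\<^esub>)\<rparr>"

lemma group_semidirect_product:
  assumes "group K" "group H" and \<phi>: "\<phi> \<in> hom H (AutoGroup K)"
  shows "group (semidirect_product K H \<phi>)"
proof -
  interpret K: group K by fact
  interpret H: group H by fact
  interpret A: group "AutoGroup K" by (rule K.AutoGroup)
  interpret \<phi>: group_hom H "AutoGroup K" \<phi> by unfold_locales (rule \<phi>)
  have aut: "\<phi> y \<in> hom K K" "\<phi> y \<in> Bij (carrier K)" if "y \<in> carrier H" for y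
    using \<phi>.hom_closed[OF that] by (simp_all add: AutoGroup_def auto_def)
  have cl: "\<phi> y x \<in> carrier K" if "y \<in> carrier H" "x \<in> carrier K" for x y
    using aut[OF that(1)] that(2) by (blast dest: hom_in_carrier)
  have mul: "\<phi> y (x \<otimes>\<^bsub>K\<^esub> x') = \<phi> y x \<otimes>\<^bsub>K\<^esub> \<phi> y x'"
    if "y \<in> carrier H" "x \<in> carrier K" "x' \<in> carrier K" for x x' y
    using aut[OF that(1)] that(2,3) by (blast dest: hom_mult)
  have act: "\<phi> (y \<otimes>\<^bsub>H\<^esub> y') x = \<phi> y (\<phi> y' x)"
    if "y \<in> carrier H" "y' \<in> carrier H" "x \<in> carrier K" for x y y'
  proof -
    have "\<phi> (y \<otimes>\<^bsub>H\<^esub> y') = compose (carrier K) (\<phi> y) (\<phi> y')"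
      unfolding \<phi>.hom_mult[OF that(1,2)]
      using aut[OF that(1)] aut[OF that(2)] by (simp add: AutoGroup_def BijGroup_def)
    then show ?thesis
      using that(3) by (simp only: compose_eq)
  qed
  have one: "\<phi> \<one>\<^bsub>H\<^esub> x = x" if "x \<in> carrier K" for x
    unfolding \<phi>.hom_one using that by (simp add: AutoGroup_def BijGroup_def)
  let ?S = "semidirect_product K H \<phi>"
  have carrier: "carrier ?S = carrier K \<times> carrier H"
    and mult: "(x, y) \<otimes>\<^bsub>?S\<^esub> (x', y') = (x \<otimes>\<^bsub>K\<^esub> \<phi> y x', y \<otimes>\<^bsub>H\<^esub> y')"
    and unit: "\<one>\<^bsub>?S\<^esub> = (\<one>\<^bsub>K\<^esub>, \<one>\<^bsub>H\<^esub>)" for x y x' y'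
    by (simp_all add: semidirect_product_def)
  show ?thesis
  proof (rule groupI)
    fix u v assume "u \<in> carrier ?S" "v \<in> carrier ?S"
    then show "u \<otimes>\<^bsub>?S\<^esub> v \<in> carrier ?S"
      by (cases u, cases v) (simp add: carrier mult cl)
  next
    show "\<one>\<^bsub>?S\<^esub> \<in> carrier ?S"
      by (simp add: carrier unit)
  next
    fix u v w assume "u \<in> carrier ?S" "v \<in> carrier ?S" "w \<in> carrier ?S"
    then show "u \<otimes>\<^bsub>?S\<^esub> v \<otimes>\<^bsub>?S\<^esub> w = u \<otimes>\<^bsub>?S\<^esub> (v \<otimes>\<^bsub>?S\<^esub> w)"
      by (cases u, cases v, cases w) (simp add: carrier mult cl mul act K.m_assoc H.m_assoc del: \<phi>.hom_mult)
  next
    fix u assume "u \<in> carrier ?S"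
    then show "\<one>\<^bsub>?S\<^esub> \<otimes>\<^bsub>?S\<^esub> u = u"
      by (cases u) (simp add: carrier mult unit one del: \<phi>.hom_one)
  next
    fix z assume "z \<in> carrier ?S"
    then obtain x y where z: "z = (x, y)" "x \<in> carrier K" "y \<in> carrier H"
      by (cases z) (auto simp: carrier)
    let ?y = "inv\<^bsub>H\<^esub> y"
    have y: "?y \<in> carrier H" using z by simp
    have "\<phi> ?y \<one>\<^bsub>K\<^esub> \<otimes>\<^bsub>K\<^esub> \<phi> ?y \<one>\<^bsub>K\<^esub> = \<phi> ?y \<one>\<^bsub>K\<^esub>"
      using mul[OF y K.one_closed K.one_closed] by simp
    then have fix_one: "\<phi> ?y \<one>\<^bsub>K\<^esub> = \<one>\<^bsub>K\<^esub>"
      using K.l_cancel_one[OF cl[OF y K.one_closed] cl[OF y K.one_closed]] by blast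
    have "\<phi> ?y (inv\<^bsub>K\<^esub> x) \<otimes>\<^bsub>K\<^esub> \<phi> ?y x = \<one>\<^bsub>K\<^esub>"
      using mul[OF y K.inv_closed[OF z(2)] z(2)] z fix_one by simp
    then have "(\<phi> ?y (inv\<^bsub>K\<^esub> x), ?y) \<otimes>\<^bsub>?S\<^esub> z = \<one>\<^bsub>?S\<^esub>"
      using z by (simp add: mult unit)
    moreover have "(\<phi> ?y (inv\<^bsub>K\<^esub> x), ?y) \<in> carrier ?S"
      using z y by (simp add: carrier cl del: \<phi>.hom_inv)
    ultimately show "\<exists>w\<in>carrier ?S. w \<otimes>\<^bsub>?S\<^esub> z = \<one>\<^bsub>?S\<^esub>"
      by blast
  qed
qed

end

theory Submission
  imports Defs "HOL-Number_Theory.Residue_Primitive_Roots"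
begin

text \<open>The group \<open>G\<close> is the direct product of the dihedral group \<open>\<langle>b, c\<rangle>\<close> of order \<open>2p\<close>, of
  \<open>\<langle>a\<rangle>\<close> of order 2 and of \<open>\<langle>d\<rangle>\<close> of order \<open>p\<close>, so each element has exactly one
  normal form \<open>c\<^sup>k d\<^sup>j b\<^sup>s a\<^sup>e\<close>. The relations leave an automorphism little freedom: \<open>a\<close> is fixed, \<open>c\<close> goes to \<open>c\<^sup>i\<close> and \<open>d\<close> to \<open>d\<^sup>m\<close> with \<open>i\<close> and \<open>m\<close> prime to \<open>p\<close>,
  and the non-central involution \<open>b\<close> goes to a non-central involution \<open>c\<^sup>t b a\<^sup>f\<close>. All choices
  of \<open>(t, i, m, f)\<close> occur. Composition multiplies \<open>i\<close> and \<open>m\<close>, adds \<open>f\<close> modulo 2, and combines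
  \<open>t\<close> and \<open>t'\<close> to \<open>t + i t'\<close>. A primitive root modulo \<open>p\<close> identifies the units modulo \<open>p\<close>
  with \<open>\<int>\<^sub>p\<^sub>-\<^sub>1\<close>, and the parameters \<open>(t, ((i, m), f))\<close> become the semidirect product,
  where \<open>i\<close> acts on \<open>t\<close> by multiplication.

  To compute with normal forms, the tuples \<open>(k, j, s, e)\<close> are made into a group, the
  model. The multiplication is chosen so that tuples map homomorphically to every
  group with four elements satisfying the relations (\<open>word_of_hom\<close>). Conversely, the
  presented group maps to the model by its universal property (\<open>presented_group_universal\<close>), and the
  two maps are mutually inverse (\<open>presented_iso_model\<close>). This replaces an analysis of the
  word problem. The automorphisms of the model are determined in \<open>auto_model_eq\<close> and
  assembled into the semidirect product in \<open>model_AutoGroup_semidirect\<close>.\<close>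

section \<open>Maps out of a presented group\<close>

definition eval_word :: "('a, 'm) monoid_scheme \<Rightarrow> ('x \<Rightarrow> 'a) \<Rightarrow> 'x word \<Rightarrow> 'a" where
  "eval_word H f w = foldr (\<lambda>(x, s) y. (if s then f x else inv\<^bsub>H\<^esub> f x) \<otimes>\<^bsub>H\<^esub> y) w \<one>\<^bsub>H\<^esub>"

context group
begin

context
  fixes f :: "'x \<Rightarrow> 'a"
  assumes f: "f x \<in> carrier G"
begin

lemma eval_word_closed: "eval_word G f w \<in> carrier G"
  by (induction w) (auto simp: eval_word_def f)

lemma eval_word_append: "eval_word G f (u @ v) = eval_word G f u \<otimes> eval_word G f v"
proof (induction u)
  case Nil
  show ?case using eval_word_closed[of v] by (simp add: eval_word_def)
next
  case (Cons a u)
  have "eval_word G f (a # w) = (if snd a then f (fst a) else inv f (fst a)) \<otimes> eval_word G f w" for w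
    by (simp add: eval_word_def case_prod_beta)
  then show ?case using Cons eval_word_closed[of v] eval_word_closed[of u] f
    by (simp add: m_assoc)
qed

lemma eval_word_equivclp:
  assumes "equivclp cancels u v"
  shows "eval_word G f u = eval_word G f v"
proof -
  have step: "eval_word G f u = eval_word G f v" if "cancels u v" for u v
    using that
  proof cases
    case (1 u' x s v')
    have "eval_word G f [(x, s), (x, \<not> s)] = \<one>"
      using f by (cases s) (auto simp: eval_word_def)
    then show ?thesis
      using eval_word_closed f unfolding 1 eval_word_append by simp
  qed
  show ?thesis
    using assms by (induction rule: equivclp_induct) (auto dest: step)
qed

text \<open>Evaluation is constant on each equivalence class of words, so any representative computes it.\<close>
lemma free_group_universal:
  obtains h where "h \<in> hom free_group G" "\<And>x. h (free_gen x) = f x"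
proof -
  define h where "h C = eval_word G f (SOME w. w \<in> C)" for C
  have h: "h (word_class w) = eval_word G f w" for w
  proof -
    have "w \<in> word_class w"
      by (simp add: word_class_def free_rel_def)
    then have "(SOME w'. w' \<in> word_class w) \<in> word_class w"
      by (rule someI)
    then show ?thesis
      unfolding h_def by (intro eval_word_equivclp[symmetric]) (simp add: word_class_def free_rel_def)
  qed
  show ?thesis
  proof
    show "h \<in> hom free_group G"
      by (auto simp: hom_def carrier_free_group h eval_word_closed mult_word_class eval_word_append)
    show "h (free_gen x) = f x" for x
      by (simp add: free_gen_def h eval_word_def f)
  qed
qed

end

lemma commutator_eq_one_iff:
  assumes "x \<in> carrier G" "y \<in> carrier G"
  shows "group_commutator G x y = \<one> \<longleftrightarrow> x \<otimes> y = y \<otimes> x"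
proof -
  have "group_commutator G x y = inv (y \<otimes> x) \<otimes> (x \<otimes> y)"
    using assms by (simp add: group_commutator_def inv_mult_group m_assoc)
  then show ?thesis
    using assms by (metis inv_closed inv_equality inv_inv l_inv m_closed)
qed

lemma int_pow_mod:
  assumes "x \<in> carrier G" "x [^] (n::nat) = \<one>"
  shows "x [^] (k mod int n) = x [^] k"
proof -
  have "x [^] k = x [^] (int n * (k div int n) + k mod int n)" by simp
  also have "\<dots> = (x [^] int n) [^] (k div int n) \<otimes> x [^] (k mod int n)"
    using assms(1) by (simp only: int_pow_mult int_pow_pow)
  also have "\<dots> = x [^] (k mod int n)"
    using assms by (simp add: int_pow_int int_pow_one)
  finally show ?thesis by simp
qed

end

lemma free_gen_closed [simp]: "free_gen x \<in> carrier free_group"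
  by (simp add: free_gen_def carrier_free_group)

definition presented_class :: "('x word set \<times> 'x word set) set \<Rightarrow> 'x word set \<Rightarrow> 'x word set set" where
  "presented_class rels = r_coset free_group
     (normal_closure free_group {u \<otimes>\<^bsub>free_group\<^esub> inv\<^bsub>free_group\<^esub> v | u v. (u, v) \<in> rels})"

context
  fixes rels :: "('x word set \<times> 'x word set) set"
  assumes rels: "rels \<subseteq> carrier free_group \<times> carrier free_group"
begin

interpretation F: group "free_group :: 'x word set monoid" by (rule group_free_group)

lemma normal_closure_rels:
  "normal_closure free_group {u \<otimes>\<^bsub>free_group\<^esub> inv\<^bsub>free_group\<^esub> v | u v. (u, v) \<in> rels} \<lhd> free_group"
  by (rule F.normal_closure_normal) (use rels in auto)

lemma presented_class_hom: "presented_class rels \<in> hom free_group (presented_group rels)"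
  unfolding presented_class_def presented_group_def
  using normal.r_coset_hom_Mod[OF normal_closure_rels] by simp

lemma presented_class_surj: "presented_class rels ` carrier free_group = carrier (presented_group rels)"
  by (auto simp: presented_class_def presented_group_def FactGroup_def RCOSETS_def)

lemma presented_class_eq:
  assumes "(u, v) \<in> rels"
  shows "presented_class rels u = presented_class rels v"
proof -
  let ?R = "{u \<otimes>\<^bsub>free_group\<^esub> inv\<^bsub>free_group\<^esub> v | u v. (u, v) \<in> rels}"
  have sub: "subgroup (normal_closure free_group ?R) free_group"
    using normal_closure_rels normal_imp_subgroup by blast
  have "u \<otimes>\<^bsub>free_group\<^esub> inv\<^bsub>free_group\<^esub> v \<in> normal_closure free_group ?R"
    using assms by (auto simp: normal_closure_def)
  moreover have uv: "u \<in> carrier free_group" "v \<in> carrier free_group" using assms rels by auto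
  ultimately have "u \<in> presented_class rels v"
    unfolding presented_class_def
    using subgroup.rcos_module_rev[OF sub F.is_group] by blast
  then show ?thesis
    unfolding presented_class_def using F.repr_independence[OF _ uv(2) sub] by auto
qed

text \<open>The kernel of a homomorphism that respects the relations is normal and contains the relators,
  hence contains their normal closure.\<close>
lemma presented_group_universal:
  assumes "group H" and h: "h \<in> hom free_group H" and eq: "\<And>u v. (u, v) \<in> rels \<Longrightarrow> h u = h v"
  obtains g where "g \<in> hom (presented_group rels) H"
    "\<And>x. x \<in> carrier free_group \<Longrightarrow> g (presented_class rels x) = h x"
proof -
  interpret H: group H by fact
  interpret h: group_hom free_group H h by unfold_locales (rule h)
  let ?R = "{u \<otimes>\<^bsub>free_group\<^esub> inv\<^bsub>free_group\<^esub> v | u v. (u, v) \<in> rels}"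
  have "?R \<subseteq> kernel free_group H h"
    using rels eq by (fastforce simp: kernel_def)
  then have "normal_closure free_group ?R \<subseteq> kernel free_group H h"
    unfolding normal_closure_def using h.normal_kernel by blast
  then obtain g where "g \<in> hom (free_group Mod normal_closure free_group ?R) H"
    "\<And>x. x \<in> carrier free_group \<Longrightarrow> g (normal_closure free_group ?R #>\<^bsub>free_group\<^esub> x) = h x"
    using h.FactGroup_universal_kernel[OF normal_closure_rels] by blast
  then show ?thesis
    by (intro that[of g]) (simp_all add: presented_group_def presented_class_def)
qed

lemma presented_group_generated:
  assumes K: "subgroup K (presented_group rels)"
    and gen: "\<And>x. presented_class rels (free_gen x) \<in> K"
  shows "K = carrier (presented_group rels)"
proof
  interpret P: group "presented_group rels" by (rule group_presented_group[OF rels])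
  interpret q: group_hom free_group "presented_group rels" "presented_class rels"
    by unfold_locales (rule presented_class_hom)
  interpret K: subgroup K "presented_group rels" by (rule K)
  have "presented_class rels (word_class w) \<in> K" for w
  proof (induction w)
    case Nil
    show ?case using q.hom_one by (simp add: one_free_group)
  next
    case (Cons l w)
    obtain x s where l: "l = (x, s)" by fastforce
    have inv: "inv\<^bsub>free_group\<^esub> (free_gen x) = word_class [(x, False)]"
      by (rule F.inv_equality)
        (use word_class_inv_word[of "[(x, True)]"]
         in \<open>auto simp: carrier_free_group free_gen_def mult_word_class inv_word_def one_free_group\<close>)
    have "presented_class rels (word_class [l]) \<in> K"
      using gen[of x] q.hom_inv[OF free_gen_closed[of x]] inv l by (cases s) (auto simp: free_gen_def[symmetric])
    moreover have "presented_class rels (word_class (l # w)) =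
        presented_class rels (word_class [l]) \<otimes>\<^bsub>presented_group rels\<^esub> presented_class rels (word_class w)"
      using q.hom_mult[of "word_class [l]" "word_class w"]
      by (simp add: mult_word_class carrier_free_group)
    ultimately show ?case using Cons by simp
  qed
  then show "carrier (presented_group rels) \<subseteq> K"
    unfolding presented_class_surj[symmetric] carrier_free_group by auto
qed (use K subgroup.subset in blast)

end

section \<open>Normal forms and a concrete model of the group\<close>

definition satisfies_rels :: "('a, 'm) monoid_scheme \<Rightarrow> nat \<Rightarrow> 'a \<Rightarrow> 'a \<Rightarrow> 'a \<Rightarrow> 'a \<Rightarrow> bool" where
  "satisfies_rels H p a b c d \<longleftrightarrow>
     {a, b, c, d} \<subseteq> carrier H \<and>
     a [^]\<^bsub>H\<^esub> (2::nat) = \<one>\<^bsub>H\<^esub> \<and> b [^]\<^bsub>H\<^esub> (2::nat) = \<one>\<^bsub>H\<^esub> \<and>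
     c [^]\<^bsub>H\<^esub> p = \<one>\<^bsub>H\<^esub> \<and> d [^]\<^bsub>H\<^esub> p = \<one>\<^bsub>H\<^esub> \<and>
     a \<otimes>\<^bsub>H\<^esub> b = b \<otimes>\<^bsub>H\<^esub> a \<and> a \<otimes>\<^bsub>H\<^esub> c = c \<otimes>\<^bsub>H\<^esub> a \<and> a \<otimes>\<^bsub>H\<^esub> d = d \<otimes>\<^bsub>H\<^esub> a \<and>
     b \<otimes>\<^bsub>H\<^esub> d = d \<otimes>\<^bsub>H\<^esub> b \<and> c \<otimes>\<^bsub>H\<^esub> d = d \<otimes>\<^bsub>H\<^esub> c \<and>
     inv\<^bsub>H\<^esub> b \<otimes>\<^bsub>H\<^esub> c \<otimes>\<^bsub>H\<^esub> b = inv\<^bsub>H\<^esub> c"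

lemma G_rels_subset: "G_rels p \<subseteq> carrier free_group \<times> carrier free_group"
proof -
  interpret F: group "free_group :: gens word set monoid" by (rule group_free_group)
  show ?thesis by (simp add: G_rels_def Let_def group_commutator_def)
qed

lemma hom_satisfies_rels_iff:
  assumes "group H" and h: "h \<in> hom free_group H"
  shows "(\<forall>(u, v)\<in>G_rels p. h u = h v) \<longleftrightarrow>
    satisfies_rels H p (h (free_gen gen_a)) (h (free_gen gen_b)) (h (free_gen gen_c)) (h (free_gen gen_d))"
proof -
  interpret F: group "free_group :: gens word set monoid" by (rule group_free_group)
  interpret H: group H by fact
  interpret h: group_hom free_group H h by unfold_locales (rule h)
  have com: "h (group_commutator free_group x y) = \<one>\<^bsub>H\<^esub> \<longleftrightarrow> h x \<otimes>\<^bsub>H\<^esub> h y = h y \<otimes>\<^bsub>H\<^esub> h x"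
    if "x \<in> carrier free_group" "y \<in> carrier free_group" for x y
  proof -
    have "h (group_commutator free_group x y) = group_commutator H (h x) (h y)"
      using that by (simp add: group_commutator_def)
    then show ?thesis using that H.commutator_eq_one_iff by simp
  qed
  show ?thesis
    by (simp add: G_rels_def Let_def satisfies_rels_def com h.hom_nat_pow)
qed

text \<open>The tuple \<open>(k, j, s, e)\<close> encodes \<open>c\<^sup>k d\<^sup>j b\<^sup>s a\<^sup>e\<close>. Moving \<open>b\<close> past \<open>c\<^sup>k'\<close> inverts the latter,
  whence the sign in the first coordinate; all other pairs of generators commute.\<close>
definition model :: "nat \<Rightarrow> (int \<times> int \<times> bool \<times> bool) monoid" where
  "model p = \<lparr>carrier = {0..<int p} \<times> {0..<int p} \<times> UNIV \<times> UNIV,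
     monoid.mult = (\<lambda>(k, j, s, e) (k', j', s', e').
       ((k + (if s then - k' else k')) mod int p, (j + j') mod int p, s \<noteq> s', e \<noteq> e')),
     one = (0, 0, False, False)\<rparr>"

lemma model_carrier: "carrier (model p) = {0..<int p} \<times> {0..<int p} \<times> UNIV \<times> UNIV"
  and model_mult: "(k, j, s, e) \<otimes>\<^bsub>model p\<^esub> (k', j', s', e') =
       ((k + (if s then - k' else k')) mod int p, (j + j') mod int p, s \<noteq> s', e \<noteq> e')"
  and model_one: "\<one>\<^bsub>model p\<^esub> = (0, 0, False, False)"
  by (simp_all add: model_def)

lemma group_model:
  assumes "p > 0"
  shows "group (model p)"
proof (rule groupI)
  fix x assume "x \<in> carrier (model p)"
  then obtain k j s e where x: "x = (k, j, s, e)" by (cases x)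
  let ?y = "((if s then k else - k) mod int p, (- j) mod int p, s, e)"
  have "?y \<in> carrier (model p)" "?y \<otimes>\<^bsub>model p\<^esub> x = \<one>\<^bsub>model p\<^esub>"
    using assms by (auto simp: model_carrier model_mult model_one x mod_simps)
  then show "\<exists>y\<in>carrier (model p). y \<otimes>\<^bsub>model p\<^esub> x = \<one>\<^bsub>model p\<^esub>" by blast
next
  fix x y z :: "int \<times> int \<times> bool \<times> bool"
  obtain k j s e k' j' s' e' k'' j'' s'' e'' where "x = (k, j, s, e)" "y = (k', j', s', e')" "z = (k'', j'', s'', e'')"
    by (metis prod.exhaust)
  then show "x \<otimes>\<^bsub>model p\<^esub> y \<otimes>\<^bsub>model p\<^esub> z = x \<otimes>\<^bsub>model p\<^esub> (y \<otimes>\<^bsub>model p\<^esub> z)"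
    by (cases s; cases s') (auto simp: model_mult mod_simps algebra_simps)
qed (use assms in \<open>auto simp: model_carrier model_mult model_one\<close>)

definition word_of :: "('a, 'm) monoid_scheme \<Rightarrow> 'a \<Rightarrow> 'a \<Rightarrow> 'a \<Rightarrow> 'a \<Rightarrow> int \<times> int \<times> bool \<times> bool \<Rightarrow> 'a" where
  "word_of H a b c d = (\<lambda>(k, j, s, e).
     c [^]\<^bsub>H\<^esub> k \<otimes>\<^bsub>H\<^esub> (d [^]\<^bsub>H\<^esub> j \<otimes>\<^bsub>H\<^esub> ((if s then b else \<one>\<^bsub>H\<^esub>) \<otimes>\<^bsub>H\<^esub> (if e then a else \<one>\<^bsub>H\<^esub>))))"

text \<open>With \<open>w = y\<close> this gives commuting powers; with \<open>w\<close> the inverse of \<open>y\<close> it moves \<open>b\<close> past a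
  power of \<open>c\<close>.\<close>
lemma (in group) int_pow_intertwine:
  assumes z: "z \<in> carrier G" and y: "y \<in> carrier G" and w: "w \<in> carrier G"
    and eq: "z \<otimes> y = w \<otimes> z"
  shows "z \<otimes> y [^] (k::int) = w [^] k \<otimes> z"
proof -
  have nat: "z \<otimes> y [^] n = w [^] n \<otimes> z" for n :: nat
  proof (induction n)
    case (Suc n)
    have "z \<otimes> y [^] Suc n = (z \<otimes> y [^] n) \<otimes> y"
      using z y by (simp add: m_assoc)
    also have "\<dots> = w [^] n \<otimes> (z \<otimes> y)"
      using z y w by (simp add: Suc m_assoc)
    also have "\<dots> = w [^] Suc n \<otimes> z"
      using z w by (simp add: eq m_assoc)
    finally show ?case .
  qed (use z in simp)
  show ?thesis
  proof (cases "k \<ge> 0")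
    case True
    then show ?thesis using nat[of "nat k"] by (metis int_nat_eq int_pow_int)
  next
    case False
    define n where "n = nat (- k)"
    have k: "k = - int n" using False by (simp add: n_def)
    have pw: "x [^] k = inv (x [^] n)" if "x \<in> carrier G" for x
      unfolding k using that by (simp only: int_pow_neg int_pow_int)
    have "w [^] n \<otimes> (z \<otimes> inv (y [^] n)) = z"
    proof -
      have "w [^] n \<otimes> (z \<otimes> inv (y [^] n)) = (z \<otimes> y [^] n) \<otimes> inv (y [^] n)"
        using z y w by (simp only: nat m_assoc inv_closed nat_pow_closed)
      then show ?thesis using z y by (simp add: m_assoc)
    qed
    then have "z \<otimes> inv (y [^] n) = inv (w [^] n) \<otimes> z"
      using z y w by (metis inv_closed inv_solve_left m_closed nat_pow_closed)
    then show ?thesis using pw[OF y] pw[OF w] by simp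
  qed
qed

text \<open>Half of the universal property of the model: the relations suffice to bring a product
  of two normal forms into normal form, and this collection process is the multiplication of the model.\<close>
lemma (in group) word_of_hom:
  assumes "satisfies_rels G p a b c d"
  shows "word_of G a b c d \<in> hom (model p) G"
proof -
  have cl: "a \<in> carrier G" "b \<in> carrier G" "c \<in> carrier G" "d \<in> carrier G"
    and sq: "a \<otimes> a = \<one>" "b \<otimes> b = \<one>" and pw: "c [^] p = \<one>" "d [^] p = \<one>"
    and com: "a \<otimes> b = b \<otimes> a" "a \<otimes> c = c \<otimes> a" "a \<otimes> d = d \<otimes> a" "b \<otimes> d = d \<otimes> b" "d \<otimes> c = c \<otimes> d"
    and inv: "inv b \<otimes> c \<otimes> b = inv c"
    using assms by (auto simp: satisfies_rels_def numeral_2_eq_2)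
  have "inv b = b" using sq(2) cl(2) inv_equality by blast
  then have bc: "b \<otimes> c = inv c \<otimes> b"
    using inv cl sq by (metis inv_closed inv_solve_right m_assoc m_closed)
  define B where "B s = (if s then b else \<one>)" for s
  define A where "A e = (if e then a else \<one>)" for e
  have AB [simp]: "A e \<in> carrier G" "B s \<in> carrier G" for e s
    by (simp_all add: A_def B_def cl)
  have Bc: "B s \<otimes> c [^] k = c [^] (if s then - k else k) \<otimes> B s" for s and k :: int
  proof (cases s)
    case True
    have "b \<otimes> c [^] k = inv c [^] k \<otimes> b"
      by (rule int_pow_intertwine) (simp_all add: cl bc)
    also have "inv c [^] k = c [^] (- k)"
      by (simp add: cl int_pow_neg int_pow_inv)
    finally show ?thesis using True by (simp add: B_def)
  qed (simp add: B_def cl)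
  have Ac: "A e \<otimes> c [^] k = c [^] k \<otimes> A e" and Ad: "A e \<otimes> d [^] k = d [^] k \<otimes> A e"
    and Bd: "B s \<otimes> d [^] k = d [^] k \<otimes> B s" for e s and k :: int
    by (rule int_pow_intertwine; simp add: cl com A_def B_def)+
  have "d [^] j \<otimes> c = c \<otimes> d [^] j" for j :: int
    using int_pow_intertwine[of c d d j] cl com by simp
  then have dc: "d [^] j \<otimes> c [^] k = c [^] k \<otimes> d [^] j" for j k :: int
    by (intro int_pow_intertwine) (simp_all add: cl)
  have ABc: "A e \<otimes> B s = B s \<otimes> A e" for e s
    by (simp add: A_def B_def cl com)
  have AA: "A e \<otimes> A e' = A (e \<noteq> e')" and BB: "B s \<otimes> B s' = B (s \<noteq> s')" for e e' s s'
    by (auto simp: A_def B_def sq cl)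
  have L: "x \<otimes> (y \<otimes> z) = (x \<otimes> y) \<otimes> z"
    if "x \<in> carrier G" "y \<in> carrier G" "z \<in> carrier G" for x y z
    using that by (simp add: m_assoc)
  have left: "x \<otimes> (y \<otimes> z) = v \<otimes> (w \<otimes> z)"
    if "x \<otimes> y = v \<otimes> w" "x \<in> carrier G" "y \<in> carrier G" "z \<in> carrier G" "v \<in> carrier G" "w \<in> carrier G"
    for x y z v w
    using that by (metis m_assoc)
  have "word_of G a b c d ((k, j, s, e) \<otimes>\<^bsub>model p\<^esub> (k', j', s', e')) =
     word_of G a b c d (k, j, s, e) \<otimes> word_of G a b c d (k', j', s', e')"
    for k j s e k' j' s' e'
  proof -
    let ?k' = "if s then - k' else k'"
    have "word_of G a b c d (k, j, s, e) \<otimes> word_of G a b c d (k', j', s', e') =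
       c [^] k \<otimes> (d [^] j \<otimes> (B s \<otimes> (A e \<otimes> (c [^] k' \<otimes> (d [^] j' \<otimes> (B s' \<otimes> A e'))))))"
      by (simp add: word_of_def flip: A_def B_def) (simp add: m_assoc cl)
    also have "A e \<otimes> (c [^] k' \<otimes> (d [^] j' \<otimes> (B s' \<otimes> A e'))) =
        c [^] k' \<otimes> (d [^] j' \<otimes> (B s' \<otimes> A (e \<noteq> e')))"
      by (simp add: left[OF Ac] left[OF Ad] left[OF ABc] cl AA)
    also have "B s \<otimes> \<dots> = c [^] ?k' \<otimes> (d [^] j' \<otimes> (B (s \<noteq> s') \<otimes> A (e \<noteq> e')))"
    proof -
      have "B s \<otimes> (c [^] k' \<otimes> (d [^] j' \<otimes> (B s' \<otimes> A (e \<noteq> e')))) =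
          c [^] ?k' \<otimes> (d [^] j' \<otimes> (B s \<otimes> (B s' \<otimes> A (e \<noteq> e'))))"
        using left[OF Bc[of s k'], where z = "d [^] j' \<otimes> (B s' \<otimes> A (e \<noteq> e'))"]
          left[OF Bd[of s j'], where z = "B s' \<otimes> A (e \<noteq> e')"] by (simp only: cl AB int_pow_closed m_closed)
      then show ?thesis by (simp only: L AB BB)
    qed
    also have "d [^] j \<otimes> \<dots> = c [^] ?k' \<otimes> (d [^] (j + j') \<otimes> (B (s \<noteq> s') \<otimes> A (e \<noteq> e')))"
      by (simp add: left[OF dc] cl int_pow_mult m_assoc)
    also have "c [^] k \<otimes> \<dots> = c [^] (k + ?k') \<otimes> (d [^] (j + j') \<otimes> (B (s \<noteq> s') \<otimes> A (e \<noteq> e')))"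
      by (simp add: cl int_pow_mult m_assoc)
    also have "\<dots> = word_of G a b c d ((k, j, s, e) \<otimes>\<^bsub>model p\<^esub> (k', j', s', e'))"
      unfolding model_mult word_of_def prod.case int_pow_mod[OF cl(3) pw(1)] int_pow_mod[OF cl(4) pw(2)]
        A_def B_def ..
    finally show ?thesis by simp
  qed
  then show ?thesis
    by (auto simp: hom_def model_carrier word_of_def cl)
qed

lemma mod_affine:
  fixes n :: int
  shows "(i * (x mod n) + t) mod n = (i * x + t) mod n" "((x mod n) * i + t) mod n = (x * i + t) mod n"
  by (metis mod_add_left_eq mod_mult_right_eq, metis mod_add_left_eq mod_mult_left_eq)

lemma mod_eq_diff:
  fixes x y z n :: int
  assumes "x mod n = y mod n" "x - y = z"
  shows "z mod n = 0"
  using assms by (simp add: mod_eq_dvd_iff dvd_eq_mod_eq_0)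

lemma prime_dvd_mult_int:
  fixes i k :: int
  assumes "Factorial_Ring.prime p" "int p dvd i * k" "i \<in> {1..<int p}"
  shows "int p dvd k"
proof -
  have "\<not> int p dvd i" using assms(3) by (auto dest: zdvd_imp_le)
  then show ?thesis using assms(1,2) prime_dvd_mult_iff[of "int p" i k] by simp
qed

lemma model_c_pow: "(1, 0, False, False) [^]\<^bsub>model p\<^esub> n = (int n mod int p, 0, False, False)" for n :: nat
  by (induction n) (auto simp: model_one model_mult mod_simps add.commute)

lemma model_d_pow: "(0, 1, False, False) [^]\<^bsub>model p\<^esub> n = (0, int n mod int p, False, False)" for n :: nat
  by (induction n) (auto simp: model_one model_mult mod_simps add.commute)

text \<open>Applied to the model, where every element is its own normal form in the generators, this shows
  that a homomorphism is determined by the images of the four generators.\<close>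
lemma (in group) hom_word_of:
  assumes "group H" "h \<in> hom G H" "{a, b, c, d} \<subseteq> carrier G"
  shows "h (word_of G a b c d x) = word_of H (h a) (h b) (h c) (h d) x"
proof -
  interpret H: group H by fact
  interpret h: group_hom G H h by unfold_locales fact
  show ?thesis using assms(3)
    by (auto simp: word_of_def h.hom_int_pow split: prod.splits)
qed

context
  fixes p :: nat
  assumes p: "Factorial_Ring.prime p" "p \<noteq> 2"
begin

interpretation M: group "model p"
  by (rule group_model) (use p prime_gt_0_nat in blast)

lemma p_gt_2: "p > 2"
  using prime_gt_1_nat[OF p(1)] p(2) by linarith

lemma double_mod_eq_0:
  assumes "0 \<le> k" "k < int p" "(k + k) mod int p = 0"
  shows "k = 0"
proof -
  have "int p dvd 2 * k" using assms(3) unfolding mult_2 by (rule dvd_eq_mod_eq_0[THEN iffD2])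
  then have "int p dvd k" by (rule prime_dvd_mult_int[OF p(1)]) (use p_gt_2 in simp)
  then show ?thesis using assms(1,2) by (metis order_le_less zdvd_not_zless)
qed

lemma model_satisfies_rels:
  "satisfies_rels (model p) p (0, 0, False, True) (0, 0, True, False) (1, 0, False, False) (0, 1, False, False)"
proof -
  have "inv\<^bsub>model p\<^esub> (0, 0, True, False) = (0, 0, True, False)"
    "inv\<^bsub>model p\<^esub> (1, 0, False, False) = (- 1 mod int p, 0, False, False)"
    by (rule M.inv_equality; use p_gt_2 in \<open>simp add: model_carrier model_mult model_one mod_simps\<close>)+
  then show ?thesis
    using p_gt_2 by (simp add: satisfies_rels_def numeral_2_eq_2 model_carrier model_mult model_one model_c_pow model_d_pow)
qed

lemma word_of_model:
  assumes "x \<in> carrier (model p)"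
  shows "word_of (model p) (0, 0, False, True) (0, 0, True, False) (1, 0, False, False) (0, 1, False, False) x = x"
proof -
  obtain k j s e where x: "x = (int k, int j, s, e)" "k < p" "j < p"
    using assms by (cases x) (auto simp: model_carrier elim!: nonneg_int_cases)
  then show ?thesis
    by (simp add: word_of_def int_pow_int model_c_pow model_d_pow model_mult model_one)
qed

text \<open>The normal form map from the model hits all generators, hence is onto; the map back given by the
  presentation sends each normal form to its tuple, hence the normal form map is injective.\<close>
lemma presented_iso_model: "presented_group (G_rels p) \<cong> model p"
proof -
  let ?P = "presented_group (G_rels p)" and ?q = "presented_class (G_rels p)"
  interpret F: group "free_group :: gens word set monoid" by (rule group_free_group)
  interpret P: group ?P by (rule group_presented_group_G_rels)
  interpret q: group_hom free_group ?P ?q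
    by unfold_locales (rule presented_class_hom[OF G_rels_subset])
  let ?n = "word_of ?P (?q (free_gen gen_a)) (?q (free_gen gen_b)) (?q (free_gen gen_c)) (?q (free_gen gen_d))"
  have "satisfies_rels ?P p (?q (free_gen gen_a)) (?q (free_gen gen_b)) (?q (free_gen gen_c)) (?q (free_gen gen_d))"
    using hom_satisfies_rels_iff[OF P.is_group q.homh, of p] presented_class_eq[OF G_rels_subset] by blast
  then have n: "?n \<in> hom (model p) ?P" by (rule P.word_of_hom)
  interpret n: group_hom "model p" ?P ?n by unfold_locales (rule n)
  define f where "f x = (case x of gen_a \<Rightarrow> (0, 0, False, True) | gen_b \<Rightarrow> (0, 0, True, False)
    | gen_c \<Rightarrow> (1, 0, False, False) | gen_d \<Rightarrow> (0 :: int, 1 :: int, False, False))" for x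
  have "f x \<in> carrier (model p)" for x
    using p_gt_2 by (cases x) (auto simp: f_def model_carrier)
  then obtain h where h: "h \<in> hom free_group (model p)" "\<And>x. h (free_gen x) = f x"
    using M.free_group_universal by blast
  then have "satisfies_rels (model p) p (h (free_gen gen_a)) (h (free_gen gen_b)) (h (free_gen gen_c)) (h (free_gen gen_d))"
    using model_satisfies_rels by (simp add: f_def)
  then have "\<And>u v. (u, v) \<in> G_rels p \<Longrightarrow> h u = h v"
    using hom_satisfies_rels_iff[OF M.is_group h(1), of p] by blast
  then obtain g where g: "g \<in> hom ?P (model p)" "\<And>x. x \<in> carrier free_group \<Longrightarrow> g (?q x) = h x"
    using presented_group_universal[OF G_rels_subset M.is_group h(1)] by metis
  have gn: "g (?n x) = x" if "x \<in> carrier (model p)" for x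
    using word_of_model[OF that] P.hom_word_of[OF M.is_group g(1)] by (simp add: g(2) h(2) f_def)
  have gen: "?q (free_gen x) \<in> ?n ` carrier (model p)" for x
  proof
    show "f x \<in> carrier (model p)" by fact
    show "?q (free_gen x) = ?n (f x)"
      by (cases x) (simp_all add: f_def word_of_def)
  qed
  have "?n ` carrier (model p) = carrier ?P"
    by (rule presented_group_generated[OF G_rels_subset n.img_is_subgroup gen])
  moreover have "inj_on ?n (carrier (model p))"
    by (rule inj_on_inverseI[where g = g]) (rule gn)
  ultimately have "?n \<in> iso (model p) ?P"
    using n by (simp add: iso_def bij_betw_def)
  then show ?thesis
    using M.iso_sym is_isoI by blast
qed

end

section \<open>The automorphisms of the model\<close>

text \<open>The effect on normal forms of \<open>c \<mapsto> c\<^sup>i\<close>, \<open>d \<mapsto> d\<^sup>m\<close>, \<open>b \<mapsto> c\<^sup>t b a\<^sup>f\<close>, \<open>a \<mapsto> a\<close>. The function is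
  restricted to the carrier because automorphisms are compared as extensional functions.\<close>
definition model_aut :: "nat \<Rightarrow> int \<Rightarrow> int \<Rightarrow> int \<Rightarrow> bool \<Rightarrow> int \<times> int \<times> bool \<times> bool \<Rightarrow> int \<times> int \<times> bool \<times> bool" where
  "model_aut p t i m f = restrict
     (\<lambda>(k, j, s, e). ((i * k + (if s then t else 0)) mod int p, m * j mod int p, s, e \<noteq> (s \<and> f)))
     (carrier (model p))"

context
  fixes p :: nat
  assumes p: "Factorial_Ring.prime p" "p \<noteq> 2"
begin

interpretation M: group "model p"
  by (rule group_model) (use p prime_gt_0_nat in blast)

lemma unit_mult_cancel:
  assumes "i \<in> {1..<int p}" "k \<in> {0..<int p}" "k' \<in> {0..<int p}" "i * k mod int p = i * k' mod int p"
  shows "k = k'"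
proof -
  have "int p dvd i * (k - k')" using assms(4) by (simp add: mod_eq_dvd_iff right_diff_distrib)
  then have "int p dvd k - k'" using prime_dvd_mult_int[OF p(1)] assms(1) by blast
  then have "k mod int p = k' mod int p" by (simp add: mod_eq_dvd_iff)
  then show ?thesis using assms by simp
qed

lemma model_aut_in_auto:
  assumes "i \<in> {1..<int p}" "m \<in> {1..<int p}"
  shows "model_aut p t i m f \<in> auto (model p)"
proof -
  let ?\<alpha> = "model_aut p t i m f"
  have into: "?\<alpha> x \<in> carrier (model p)" if "x \<in> carrier (model p)" for x
    using that p_gt_2[OF p] by (auto simp: model_aut_def model_carrier)
  have "?\<alpha> (x \<otimes>\<^bsub>model p\<^esub> y) = ?\<alpha> x \<otimes>\<^bsub>model p\<^esub> ?\<alpha> y"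
    if x: "x \<in> carrier (model p)" and y: "y \<in> carrier (model p)" for x y
  proof -
    obtain k j s e k' j' s' e' where xy: "x = (k, j, s, e)" "y = (k', j', s', e')" by (metis prod.exhaust)
    have *: "x \<otimes>\<^bsub>model p\<^esub> y \<in> carrier (model p)" using x y by simp
    show ?thesis
      using * x y unfolding model_aut_def restrict_apply' [OF *] restrict_apply'[OF x] restrict_apply'[OF y]
      unfolding xy model_mult prod.case
      by (cases s; cases s') (simp_all add: mod_affine mod_simps, auto simp: algebra_simps)
  qed
  then have hom: "?\<alpha> \<in> hom (model p) (model p)"
    using into by (simp add: hom_def)
  have "inj_on ?\<alpha> (carrier (model p))"
  proof (rule inj_onI)
    fix x y assume x: "x \<in> carrier (model p)" and y: "y \<in> carrier (model p)" and eq: "?\<alpha> x = ?\<alpha> y"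
    obtain k j s e k' j' s' e' where xy: "x = (k, j, s, e)" "y = (k', j', s', e')" by (metis prod.exhaust)
    have s: "s = s'" and "j = j'" and e: "e = e'"
      and k: "(i * k + (if s then t else 0)) mod int p = (i * k' + (if s' then t else 0)) mod int p"
      using eq x y unit_mult_cancel[OF assms(2), of j j']
      by (auto simp: model_aut_def xy model_carrier)
    moreover have "i * k mod int p = i * k' mod int p"
      using k unfolding s mod_eq_dvd_iff by simp
    then have "k = k'"
      by (rule unit_mult_cancel[OF assms(1), rotated 2]) (use x y in \<open>simp_all add: xy model_carrier\<close>)
    ultimately show "x = y" by (simp add: xy)
  qed
  moreover have "finite (carrier (model p))" by (simp add: model_carrier)
  ultimately have "bij_betw ?\<alpha> (carrier (model p)) (carrier (model p))"
    unfolding bij_betw_def using into by (simp add: endo_inj_surj image_subset_iff)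
  then show ?thesis
    using hom by (simp add: auto_def Bij_def model_aut_def)
qed

lemma model_aut_compose:
  "compose (carrier (model p)) (model_aut p t i m f) (model_aut p t' i' m' f') =
     model_aut p ((t + i * t') mod int p) (i * i' mod int p) (m * m' mod int p) (f \<noteq> f')"
proof
  fix x :: "int \<times> int \<times> bool \<times> bool"
  obtain k j s e where x: "x = (k, j, s, e)" by (metis prod.exhaust)
  show "compose (carrier (model p)) (model_aut p t i m f) (model_aut p t' i' m' f') x =
     model_aut p ((t + i * t') mod int p) (i * i' mod int p) (m * m' mod int p) (f \<noteq> f') x"
  proof (cases "x \<in> carrier (model p)")
    case True
    then show ?thesis
      using p_gt_2[OF p]
      by (cases s) (simp_all add: x compose_def model_aut_def model_carrier mod_affine mod_simps,
          auto simp: algebra_simps)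
  next
    case False
    then show ?thesis by (simp add: compose_def model_aut_def)
  qed
qed

lemma model_aut_inject:
  assumes "t \<in> {0..<int p}" "t' \<in> {0..<int p}" "i \<in> {1..<int p}" "i' \<in> {1..<int p}"
    "m \<in> {1..<int p}" "m' \<in> {1..<int p}" and eq: "model_aut p t i m f = model_aut p t' i' m' f'"
  shows "t = t' \<and> i = i' \<and> m = m' \<and> f = f'"
  using fun_cong[OF eq, of "(0, 0, True, False)"] fun_cong[OF eq, of "(1, 1, False, False)"] p_gt_2[OF p] assms(1-6)
  by (simp add: model_aut_def model_carrier)

text \<open>Every relation between generators restricts the coordinates of their images. As \<open>p\<close> is odd, \<open>c\<close> and \<open>d\<close>
  are squares, so their images have no component in \<open>b\<close> or \<open>a\<close>. The relation \<open>c b c = b\<close> kills the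
  \<open>d\<close>-component of the image of \<open>c\<close>, and being an involution kills that of the images of \<open>a\<close> and \<open>b\<close>.
  The image of \<open>b\<close> must involve \<open>b\<close>, as it does not commute with that of \<open>c\<close>. So it inverts powers
  of \<open>c\<close>, and the image of \<open>d\<close>, which commutes with it, has no \<open>c\<close>-component. The image of \<open>a\<close>
  commutes with that of \<open>c\<close>, so it does not involve \<open>b\<close>, and as an involution it can only be \<open>a\<close>.\<close>
lemma auto_model_eq:
  assumes \<alpha>: "\<alpha> \<in> auto (model p)"
  obtains t i m f where "t \<in> {0..<int p}" "i \<in> {1..<int p}" "m \<in> {1..<int p}" "\<alpha> = model_aut p t i m f"
proof -
  let ?M = "model p"
  let ?a = "(0, 0, False, True) :: int \<times> int \<times> bool \<times> bool"
  let ?b = "(0, 0, True, False) :: int \<times> int \<times> bool \<times> bool"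
  let ?c = "(1, 0, False, False) :: int \<times> int \<times> bool \<times> bool"
  let ?d = "(0, 1, False, False) :: int \<times> int \<times> bool \<times> bool"
  have hom: "\<alpha> \<in> hom ?M ?M" and bij: "bij_betw \<alpha> (carrier ?M) (carrier ?M)"
    and ext: "\<alpha> \<in> extensional (carrier ?M)"
    using \<alpha> by (auto simp: auto_def Bij_def)
  interpret \<alpha>: group_hom ?M ?M \<alpha> by unfold_locales (rule hom)
  have inj: "\<alpha> x = \<alpha> y \<longleftrightarrow> x = y" if "x \<in> carrier ?M" "y \<in> carrier ?M" for x y
    using bij that by (auto simp: bij_betw_def inj_on_def)
  have gens: "?a \<in> carrier ?M" "?b \<in> carrier ?M" "?c \<in> carrier ?M" "?d \<in> carrier ?M"
    using p_gt_2[OF p] by (auto simp: model_carrier)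
  have dbl: "k = 0" if "(k + k) mod int p = 0" "k \<in> {0..<int p}" for k
    by (rule double_mod_eq_0[OF p]) (use that in simp_all)
  \<comment> \<open>half of 1 modulo \<open>p\<close>, the exponent of a square root of \<open>c\<close> and of \<open>d\<close>\<close>
  define h where "h = (int p + 1) div 2"
  have h: "h + h = int p + 1" "0 \<le> h" "h < int p"
    using prime_odd_nat[OF p(1)] p_gt_2[OF p] unfolding h_def by (auto elim!: oddE)
  obtain ak aj as ae where a: "\<alpha> ?a = (ak, aj, as, ae)" by (metis prod.exhaust)
  obtain bk bj bs be where b: "\<alpha> ?b = (bk, bj, bs, be)" by (metis prod.exhaust)
  obtain ck cj cs ce where c: "\<alpha> ?c = (ck, cj, cs, ce)" by (metis prod.exhaust)
  obtain dk dj ds de where d: "\<alpha> ?d = (dk, dj, ds, de)" by (metis prod.exhaust)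
  have range: "ak \<in> {0..<int p}" "aj \<in> {0..<int p}" "bk \<in> {0..<int p}" "bj \<in> {0..<int p}"
     "ck \<in> {0..<int p}" "cj \<in> {0..<int p}" "dk \<in> {0..<int p}" "dj \<in> {0..<int p}"
    using \<alpha>.hom_closed[OF gens(1)] \<alpha>.hom_closed[OF gens(2)] \<alpha>.hom_closed[OF gens(3)]
      \<alpha>.hom_closed[OF gens(4)] unfolding a b c d by (simp_all add: model_carrier)
  have c_sq: "?c = (h, 0, False, False) \<otimes>\<^bsub>?M\<^esub> (h, 0, False, False)"
    and d_sq: "?d = (0, h, False, False) \<otimes>\<^bsub>?M\<^esub> (0, h, False, False)"
    using p_gt_2[OF p] by (simp_all add: model_mult h)
  \<comment> \<open>the last two coordinates are homomorphisms to the group of order 2\<close>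
  have cs: "\<not> cs" "\<not> ce" and ds: "\<not> ds" "\<not> de"
  proof -
    have sq: "\<not> fst (snd (snd (y \<otimes>\<^bsub>?M\<^esub> y))) \<and> \<not> snd (snd (snd (y \<otimes>\<^bsub>?M\<^esub> y)))" for y
      by (cases y) (auto simp: model_mult)
    have "(h, 0, False, False) \<in> carrier ?M" "(0, h, False, False) \<in> carrier ?M"
      using h by (auto simp: model_carrier)
    then have "\<alpha> ?c = \<alpha> (h, 0, False, False) \<otimes>\<^bsub>?M\<^esub> \<alpha> (h, 0, False, False)"
      "\<alpha> ?d = \<alpha> (0, h, False, False) \<otimes>\<^bsub>?M\<^esub> \<alpha> (0, h, False, False)"
      by (subst c_sq d_sq, simp)+
    then show "\<not> cs" "\<not> ce" "\<not> ds" "\<not> de"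
      using sq unfolding c d by (metis fst_conv snd_conv)+
  qed
  have "?c \<otimes>\<^bsub>?M\<^esub> ?b \<otimes>\<^bsub>?M\<^esub> ?c = ?b"
    using p_gt_2[OF p] by (simp add: model_mult)
  then have "\<alpha> ?c \<otimes>\<^bsub>?M\<^esub> \<alpha> ?b \<otimes>\<^bsub>?M\<^esub> \<alpha> ?c = \<alpha> ?b"
    using gens by (metis \<alpha>.hom_mult M.m_closed)
  then have "(cj + bj + cj) mod int p = bj mod int p"
    using range by (simp add: b c model_mult mod_simps)
  then have cj: "cj = 0"
    by (rule dbl[OF mod_eq_diff, OF _ _ range(6)]) simp
  have sq: "\<alpha> ?a \<otimes>\<^bsub>?M\<^esub> \<alpha> ?a = \<one>\<^bsub>?M\<^esub>" "\<alpha> ?b \<otimes>\<^bsub>?M\<^esub> \<alpha> ?b = \<one>\<^bsub>?M\<^esub>"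
    using \<alpha>.hom_mult[of ?a ?a] \<alpha>.hom_mult[of ?b ?b] \<alpha>.hom_one gens
    by (simp_all add: model_mult model_one)
  have aj: "aj = 0" by (rule dbl[OF _ range(2)]) (use sq(1) in \<open>simp add: a model_mult model_one\<close>)
  have bj: "bj = 0" by (rule dbl[OF _ range(4)]) (use sq(2) in \<open>simp add: b model_mult model_one\<close>)
  have bs: "bs"
  proof (rule ccontr)
    assume "\<not> bs"
    have "bk = 0" by (rule dbl[OF _ range(3)]) (use sq(2) \<open>\<not> bs\<close> in \<open>simp add: b model_mult model_one\<close>)
    then have "\<alpha> ?b \<otimes>\<^bsub>?M\<^esub> \<alpha> ?c = \<alpha> ?c \<otimes>\<^bsub>?M\<^esub> \<alpha> ?b"
      using \<open>\<not> bs\<close> cs by (simp add: b c model_mult add.commute)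
    then have "\<alpha> (?b \<otimes>\<^bsub>?M\<^esub> ?c) = \<alpha> (?c \<otimes>\<^bsub>?M\<^esub> ?b)"
      using gens by simp
    then have "?b \<otimes>\<^bsub>?M\<^esub> ?c = ?c \<otimes>\<^bsub>?M\<^esub> ?b"
      using inj gens by blast
    then show False using p_gt_2[OF p] by (simp add: model_mult zmod_minus1)
  qed
  have com: "\<alpha> x \<otimes>\<^bsub>?M\<^esub> \<alpha> y = \<alpha> y \<otimes>\<^bsub>?M\<^esub> \<alpha> x"
    if "x \<otimes>\<^bsub>?M\<^esub> y = y \<otimes>\<^bsub>?M\<^esub> x" "x \<in> carrier ?M" "y \<in> carrier ?M" for x y
    using that by (metis \<alpha>.hom_mult)
  have "\<alpha> ?d \<otimes>\<^bsub>?M\<^esub> \<alpha> ?b = \<alpha> ?b \<otimes>\<^bsub>?M\<^esub> \<alpha> ?d"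
    by (rule com[OF _ gens(4) gens(2)]) (simp add: model_mult)
  then have "(dk + bk) mod int p = (bk - dk) mod int p"
    using bs ds by (simp add: b d model_mult)
  then have dk: "dk = 0"
    by (rule dbl[OF mod_eq_diff, OF _ _ range(7)]) simp
  have not_one: "\<alpha> ?a \<noteq> \<one>\<^bsub>?M\<^esub>" "\<alpha> ?c \<noteq> \<one>\<^bsub>?M\<^esub>" "\<alpha> ?d \<noteq> \<one>\<^bsub>?M\<^esub>"
    using inj[OF gens(1) M.one_closed] inj[OF gens(3) M.one_closed] inj[OF gens(4) M.one_closed]
    unfolding \<alpha>.hom_one by (simp_all add: model_one)
  have ck: "ck \<noteq> 0" and dj: "dj \<noteq> 0"
    using not_one cs ds cj dk by (auto simp: c d model_one)
  have as: "\<not> as"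
  proof
    assume "as"
    have "\<alpha> ?a \<otimes>\<^bsub>?M\<^esub> \<alpha> ?c = \<alpha> ?c \<otimes>\<^bsub>?M\<^esub> \<alpha> ?a"
      by (rule com[OF _ gens(1) gens(3)]) (simp add: model_mult)
    then have "(ak - ck) mod int p = (ck + ak) mod int p"
      using \<open>as\<close> cs by (simp add: a c model_mult)
    then have "(ck + ak) mod int p = (ak - ck) mod int p" by simp
    then have "ck = 0"
      by (rule dbl[OF mod_eq_diff, OF _ _ range(5)]) simp
    then show False using ck by simp
  qed
  have ak: "ak = 0" by (rule dbl[OF _ range(1)]) (use sq(1) as in \<open>simp add: a model_mult model_one\<close>)
  have ae: "ae" using not_one as ak aj by (auto simp: a model_one)
  let ?\<beta> = "model_aut p bk ck dj be"
  have units: "ck \<in> {1..<int p}" "dj \<in> {1..<int p}"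
    using range ck dj by auto
  have \<beta>: "?\<beta> \<in> hom ?M ?M" "?\<beta> \<in> extensional (carrier ?M)"
    using model_aut_in_auto[OF units] by (auto simp: auto_def Bij_def)
  have "\<alpha> ?a = ?\<beta> ?a" "\<alpha> ?b = ?\<beta> ?b" "\<alpha> ?c = ?\<beta> ?c" "\<alpha> ?d = ?\<beta> ?d"
    using gens range by (simp_all add: a b c d model_aut_def cs ds cj bj aj dk bs as ak ae)
  then have "\<alpha> x = ?\<beta> x" if "x \<in> carrier ?M" for x
    using M.hom_word_of[OF M.is_group hom, of ?a ?b ?c ?d x] M.hom_word_of[OF M.is_group \<beta>(1), of ?a ?b ?c ?d x]
      word_of_model[OF p that] gens by simp
  then have "\<alpha> = ?\<beta>" using ext \<beta>(2) by (rule extensionalityI[rotated 2])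
  then show ?thesis using that range units by blast
qed

end

section \<open>Automorphism groups of isomorphic groups\<close>

lemma AutoGroup_carrier: "carrier (AutoGroup G) = auto G"
  by (simp add: AutoGroup_def)

lemma AutoGroup_mult:
  "\<lbrakk>\<alpha> \<in> auto G; \<beta> \<in> auto G\<rbrakk> \<Longrightarrow> \<alpha> \<otimes>\<^bsub>AutoGroup G\<^esub> \<beta> = compose (carrier G) \<alpha> \<beta>"
  by (simp add: AutoGroup_def BijGroup_def auto_def)

lemma conjugate_auto_hom:
  assumes "group G" "group H" and iso: "group_isomorphisms G H f g"
  shows "(\<lambda>\<alpha>. \<lambda>y\<in>carrier H. f (\<alpha> (g y))) \<in> hom (AutoGroup G) (AutoGroup H)"
proof -
  interpret G: group G by fact
  interpret H: group H by fact
  interpret A: group "AutoGroup G" by (rule G.AutoGroup)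
  have f: "f \<in> hom G H" and g: "g \<in> hom H G"
    and gf: "\<And>x. x \<in> carrier G \<Longrightarrow> g (f x) = x" and fg: "\<And>y. y \<in> carrier H \<Longrightarrow> f (g y) = y"
    using iso by (auto simp: group_isomorphisms_def)
  have fcl: "f x \<in> carrier H" if "x \<in> carrier G" for x using f that by (rule hom_in_carrier)
  have gcl: "g x \<in> carrier G" if "x \<in> carrier H" for x using g that by (rule hom_in_carrier)
  have bf: "bij_betw f (carrier G) (carrier H)" and bg: "bij_betw g (carrier H) (carrier G)"
    using group_isomorphisms_imp_iso[OF iso]
      group_isomorphisms_imp_iso[OF group_isomorphisms_sym[OF iso]] by (auto simp: iso_def)
  define \<Phi> where "\<Phi> \<alpha> = (\<lambda>y\<in>carrier H. f (\<alpha> (g y)))" for \<alpha>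
  have \<Phi>: "\<Phi> \<alpha> \<in> auto H" if "\<alpha> \<in> auto G" for \<alpha>
  proof -
    have \<alpha>: "\<alpha> \<in> hom G G" "bij_betw \<alpha> (carrier G) (carrier G)"
      using that by (auto simp: auto_def Bij_def)
    have "f \<circ> (\<alpha> \<circ> g) \<in> hom H H"
      using f g \<alpha>(1) by (auto simp: hom_def Pi_iff)
    moreover have "bij_betw (f \<circ> (\<alpha> \<circ> g)) (carrier H) (carrier H)"
      using bf bg \<alpha>(2) by (blast intro: bij_betw_trans)
    ultimately show ?thesis
      by (auto simp: auto_def Bij_def \<Phi>_def hom_def bij_betw_restrict_eq cong: bij_betw_cong)
  qed
  have "\<Phi> (compose (carrier G) \<alpha> \<beta>) = compose (carrier H) (\<Phi> \<alpha>) (\<Phi> \<beta>)"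
    if "\<alpha> \<in> auto G" "\<beta> \<in> auto G" for \<alpha> \<beta>
  proof
    fix y
    have "\<beta> (g y) \<in> carrier G" if "y \<in> carrier H"
      using \<open>\<beta> \<in> auto G\<close> gcl[OF that] by (auto simp: auto_def dest: hom_in_carrier)
    then show "\<Phi> (compose (carrier G) \<alpha> \<beta>) y = compose (carrier H) (\<Phi> \<alpha>) (\<Phi> \<beta>) y"
      by (auto simp: \<Phi>_def compose_def gf gcl fcl)
  qed
  moreover have "compose (carrier G) \<alpha> \<beta> \<in> auto G" if "\<alpha> \<in> auto G" "\<beta> \<in> auto G" for \<alpha> \<beta>
    using A.m_closed[of \<alpha> \<beta>] that by (simp add: AutoGroup_carrier AutoGroup_mult)
  ultimately have "\<Phi> \<in> hom (AutoGroup G) (AutoGroup H)"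
    using \<Phi> by (simp add: hom_def AutoGroup_carrier AutoGroup_mult)
  then show ?thesis unfolding \<Phi>_def .
qed


lemma AutoGroup_iso:
  assumes "group G" "group H" "G \<cong> H"
  shows "AutoGroup G \<cong> AutoGroup H"
proof -
  obtain f g where iso: "group_isomorphisms G H f g"
    using assms(3) group.iso_iff_group_isomorphisms[OF assms(1)] unfolding is_iso_def by blast
  let ?\<Phi> = "\<lambda>\<alpha>. \<lambda>y\<in>carrier H. f (\<alpha> (g y))" and ?\<Psi> = "\<lambda>\<beta>. \<lambda>x\<in>carrier G. g (\<beta> (f x))"
  have inv: "(\<lambda>x\<in>carrier G. g ((\<lambda>y\<in>carrier H. f (\<alpha> (g y))) (f x))) = \<alpha>"
    if "group_isomorphisms G H f g" "\<alpha> \<in> auto G" for G :: "('x, 'm) monoid_scheme" and H :: "('y, 'n) monoid_scheme" and f g \<alpha>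
  proof
    fix x
    have "\<alpha> x \<in> carrier G" if "x \<in> carrier G"
      using \<open>\<alpha> \<in> auto G\<close> that by (auto simp: auto_def dest: hom_in_carrier)
    moreover have "\<alpha> \<in> extensional (carrier G)" using that by (simp add: auto_def Bij_def)
    ultimately show "(\<lambda>x\<in>carrier G. g ((\<lambda>y\<in>carrier H. f (\<alpha> (g y))) (f x))) x = \<alpha> x"
      using that(1) by (auto simp: group_isomorphisms_def extensional_def dest: hom_in_carrier)
  qed
  have "group_isomorphisms (AutoGroup G) (AutoGroup H) ?\<Phi> ?\<Psi>"
    using conjugate_auto_hom[OF assms(1,2) iso]
      conjugate_auto_hom[OF assms(2,1) group_isomorphisms_sym[OF iso]]
      inv[OF iso] inv[OF group_isomorphisms_sym[OF iso]]
    unfolding group_isomorphisms_def[of "AutoGroup G"] AutoGroup_carrier by blast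
  then show ?thesis
    by (intro is_isoI group_isomorphisms_imp_iso)
qed

section \<open>Assembling the semidirect product\<close>

text \<open>Discrete exponentiation with a primitive root as base. The values are the least positive residues, as
  \<open>integer_mod_group\<close> and the model work with these.\<close>
lemma primitive_root_exponential:
  assumes p: "Factorial_Ring.prime (p :: nat)"
  obtains E :: "int \<Rightarrow> int" where "bij_betw E {0..<int (p - 1)} {1..<int p}"
    "\<And>u v. \<lbrakk>0 \<le> u; 0 \<le> v\<rbrakk> \<Longrightarrow> E ((u + v) mod int (p - 1)) = E u * E v mod int p"
proof -
  have p1: "p > 1" using p by (rule prime_gt_1_nat)
  obtain g where g: "residue_primroot p g" using prime_primitive_root_exists[OF p1 p] ..
  have tot: "totient p = p - 1" using p by (rule totient_prime)
  define E where "E u = int (g ^ nat u mod p)" for u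
  have "bij_betw (\<lambda>i. g ^ i mod p) {..<p - 1} {0<..<p}"
    using residue_primroot_is_generator[OF p1 g] p by (simp add: tot totatives_prime)
  moreover have "bij_betw nat {0..<int (p - 1)} {..<p - 1}"
    by (rule bij_betw_byWitness[where f' = int]) auto
  moreover have "bij_betw int {0<..<p} {1..<int p}"
    by (rule bij_betw_byWitness[where f' = nat]) auto
  ultimately have "bij_betw (int \<circ> ((\<lambda>i. g ^ i mod p) \<circ> nat)) {0..<int (p - 1)} {1..<int p}"
    by (blast intro: bij_betw_trans)
  then have "bij_betw E {0..<int (p - 1)} {1..<int p}"
    by (simp add: E_def comp_def cong: bij_betw_cong)
  moreover have "E ((u + v) mod int (p - 1)) = E u * E v mod int p" if "0 \<le> u" "0 \<le> v" for u v
  proof -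
    have "nat ((u + v) mod int (p - 1)) = (nat u + nat v) mod (p - 1)"
      using that by (simp add: nat_mod_distrib nat_add_distrib)
    moreover have "[g ^ ((nat u + nat v) mod (p - 1)) = g ^ (nat u + nat v)] (mod p)"
      using g by (subst order_divides_expdiff) (auto simp: residue_primroot_def tot cong_def)
    ultimately show ?thesis
      by (simp add: E_def cong_def power_add mod_simps flip: of_nat_mult of_nat_mod)
  qed
  ultimately show ?thesis by (rule that)
qed

text \<open>Only the exponent of the unit \<open>i\<close> acts on the translations \<open>t\<close>: by \<open>model_aut_compose\<close> the second translation is
  multiplied by \<open>i\<close>, while \<open>m\<close> and \<open>f\<close> do not enter.\<close>
lemma model_AutoGroup_semidirect:
  assumes p: "Factorial_Ring.prime (p :: nat)" "p \<noteq> 2"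
  shows "\<exists>\<phi> \<in> hom ((integer_mod_group (p - 1) \<times>\<times> integer_mod_group (p - 1)) \<times>\<times> integer_mod_group 2)
                  (AutoGroup (integer_mod_group p)).
           semidirect_product (integer_mod_group p)
               ((integer_mod_group (p - 1) \<times>\<times> integer_mod_group (p - 1)) \<times>\<times> integer_mod_group 2) \<phi>
           \<cong> AutoGroup (model p)"
proof -
  define q where "q = p - 1"
  let ?Z = integer_mod_group
  let ?K = "?Z p" and ?H = "(?Z (q) \<times>\<times> ?Z (q)) \<times>\<times> ?Z 2"
  have p2: "p > 2" by (rule p_gt_2[OF p])
  obtain E where E: "bij_betw E {0..<int (q)} {1..<int p}"
    and E_add: "\<And>u v. \<lbrakk>0 \<le> u; 0 \<le> v\<rbrakk> \<Longrightarrow> E ((u + v) mod int (q)) = E u * E v mod int p"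
    using primitive_root_exponential[OF p(1)] unfolding q_def by blast
  have E_unit: "E u \<in> {1..<int p}" if "u \<in> {0..<int (q)}" for u
    using E that by (auto simp: bij_betw_def)
  have K: "carrier ?K = {0..<int p}" and Z: "carrier (?Z (q)) = {0..<int (q)}"
    and Z2: "carrier (?Z 2) = {0, 1}"
    using p2 by (auto simp: carrier_integer_mod_group q_def)
  have H: "carrier ?H = ({0..<int (q)} \<times> {0..<int (q)}) \<times> {0, 1}"
    by (simp only: DirProd_def Z Z2 partial_object.simps)
  define \<phi> where "\<phi> h = (\<lambda>t\<in>{0..<int p}. E (fst (fst h)) * t mod int p)" for h :: "(int \<times> int) \<times> int"
  define \<Psi> where "\<Psi> = (\<lambda>(t, (u, v), f). model_aut p t (E u) (E v) (f = (1::int)))"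
  have \<phi>_auto: "\<phi> h \<in> auto ?K" if "h \<in> carrier ?H" for h
  proof -
    have u: "E (fst (fst h)) \<in> {1..<int p}"
      by (rule E_unit) (use that in \<open>auto simp: Z\<close>)
    have into: "\<phi> h t \<in> {0..<int p}" if "t \<in> {0..<int p}" for t
      using that p2 by (simp add: \<phi>_def)
    have "\<phi> h \<in> hom ?K ?K"
      using into by (auto simp: hom_def K \<phi>_def mod_simps distrib_left)
    moreover have "inj_on (\<phi> h) {0..<int p}"
      by (rule inj_onI, rule unit_mult_cancel[OF p u]) (simp_all add: \<phi>_def)
    then have "bij_betw (\<phi> h) {0..<int p} {0..<int p}"
      unfolding bij_betw_def using into by (simp add: endo_inj_surj image_subset_iff)
    ultimately show ?thesis
      by (simp add: auto_def Bij_def K \<phi>_def)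
  qed
  have "\<phi> (h \<otimes>\<^bsub>?H\<^esub> h') = compose {0..<int p} (\<phi> h) (\<phi> h')"
    if "h \<in> carrier ?H" "h' \<in> carrier ?H" for h h'
    using that p2
    by (auto simp: Z \<phi>_def compose_def E_add mod_simps mult.assoc fun_eq_iff)
  then have \<phi>: "\<phi> \<in> hom ?H (AutoGroup ?K)"
    using \<phi>_auto by (auto simp: hom_def AutoGroup_carrier AutoGroup_mult K)
  let ?S = "semidirect_product ?K ?H \<phi>"
  have S: "carrier ?S = {0..<int p} \<times> ({0..<int (q)} \<times> {0..<int (q)}) \<times> {0, 1}"
    by (simp only: semidirect_product_def partial_object.simps K H)
  have \<Psi>_auto: "\<Psi> x \<in> auto (model p)" if "x \<in> carrier ?S" for x
    using that by (auto simp: S \<Psi>_def intro!: model_aut_in_auto[OF p] E_unit)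
  have "\<Psi> (x \<otimes>\<^bsub>?S\<^esub> y) = compose (carrier (model p)) (\<Psi> x) (\<Psi> y)"
    if x: "x \<in> carrier ?S" and y: "y \<in> carrier ?S" for x y
  proof -
    obtain t u v f t' u' v' f' where xy: "x = (t, (u, v), f)" "y = (t', (u', v'), f')"
      by (metis prod.exhaust)
    have "((f + f') mod 2 = 1) = ((f = 1) \<noteq> (f' = 1))"
      using x y by (auto simp: S xy)
    moreover have "(t + \<phi> ((u, v), f) t') mod int p = (t + E u * t') mod int p"
      using y by (simp add: S xy \<phi>_def mod_simps)
    ultimately show ?thesis
      using x y unfolding xy S
      by (simp add: \<Psi>_def model_aut_compose[OF p] semidirect_product_def E_add)
  qed
  then have "\<Psi> \<in> hom ?S (AutoGroup (model p))"
    using \<Psi>_auto by (auto simp: hom_def AutoGroup_carrier AutoGroup_mult)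
  moreover have "inj_on \<Psi> (carrier ?S)"
  proof (rule inj_onI)
    fix x y assume x: "x \<in> carrier ?S" and y: "y \<in> carrier ?S" and eq: "\<Psi> x = \<Psi> y"
    obtain t u v f t' u' v' f' where xy: "x = (t, (u, v), f)" "y = (t', (u', v'), f')"
      by (metis prod.exhaust)
    have uv: "u \<in> {0..<int (q)}" "u' \<in> {0..<int (q)}" "v \<in> {0..<int (q)}" "v' \<in> {0..<int (q)}"
      and t: "t \<in> {0..<int p}" "t' \<in> {0..<int p}" and f: "f \<in> {0, 1}" "f' \<in> {0, 1}"
      using x y by (simp_all add: S xy)
    have "t = t' \<and> E u = E u' \<and> E v = E v' \<and> (f = 1) = (f' = 1)"
      using eq by (intro model_aut_inject[OF p] t E_unit uv) (simp add: \<Psi>_def xy)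
    then show "x = y"
      using uv f inj_onD[OF bij_betw_imp_inj_on[OF E]] by (auto simp: xy)
  qed
  moreover have "auto (model p) \<subseteq> \<Psi> ` carrier ?S"
  proof
    fix \<alpha> assume "\<alpha> \<in> auto (model p)"
    then obtain t i m f where "t \<in> {0..<int p}" "i \<in> {1..<int p}" "m \<in> {1..<int p}"
      and \<alpha>: "\<alpha> = model_aut p t i m f"
      by (rule auto_model_eq[OF p])
    moreover obtain u v where "u \<in> {0..<int (q)}" "v \<in> {0..<int (q)}" "E u = i" "E v = m"
      using E calculation by (metis bij_betw_def imageE)
    ultimately show "\<alpha> \<in> \<Psi> ` carrier ?S"
      by (intro image_eqI[of _ _ "(t, (u, v), of_bool f)"]) (simp_all add: S \<Psi>_def)
  qed
  ultimately have "\<Psi> \<in> iso ?S (AutoGroup (model p))"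
    using \<Psi>_auto by (auto simp: iso_def bij_betw_def AutoGroup_carrier)
  then show ?thesis
    using \<phi> is_isoI unfolding q_def by blast
qed

theorem mainTheorem16:
  fixes p :: nat
  assumes "Factorial_Ring.prime p" and "p \<noteq> 2" and "p \<noteq> 3"
  shows "\<exists>\<phi> \<in> hom ((integer_mod_group (p - 1) \<times>\<times> integer_mod_group (p - 1)) \<times>\<times> integer_mod_group 2)
                  (AutoGroup (integer_mod_group p)).
           AutoGroup (presented_group (G_rels p)) \<cong>
             semidirect_product (integer_mod_group p)
               ((integer_mod_group (p - 1) \<times>\<times> integer_mod_group (p - 1)) \<times>\<times> integer_mod_group 2) \<phi>"
proof -
  let ?H = "(integer_mod_group (p - 1) \<times>\<times> integer_mod_group (p - 1)) \<times>\<times> integer_mod_group 2"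
  obtain \<phi> where \<phi>: "\<phi> \<in> hom ?H (AutoGroup (integer_mod_group p))"
    and iso: "semidirect_product (integer_mod_group p) ?H \<phi> \<cong> AutoGroup (model p)"
    using model_AutoGroup_semidirect[OF assms(1,2)] by blast
  have "group ?H" by (intro DirProd_group) simp_all
  then have "group (semidirect_product (integer_mod_group p) ?H \<phi>)"
    using \<phi> by (intro group_semidirect_product) simp_all
  then have "AutoGroup (model p) \<cong> semidirect_product (integer_mod_group p) ?H \<phi>"
    using iso by (rule group.iso_sym)
  moreover have "group (model p)"
    using assms(1) by (intro group_model prime_gt_0_nat)
  then have "AutoGroup (presented_group (G_rels p)) \<cong> AutoGroup (model p)"
    by (intro AutoGroup_iso group_presented_group_G_rels presented_iso_model[OF assms(1,2)])
  ultimately show ?thesis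
    using \<phi> iso_trans by blast
qed

end
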